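(* Suppose $p=p(n)$ satisfies $n^{-\delta}\ll p\ll1$ for every positive constant $\delta$. Then, for any constant $\varepsilon>0$ and positive integer $k=k(n)$, as $n\to\infty$, $$\mathbb{P}\big[\mathbf{C}_{n,p}\text{ contains an increasing run of length }k\big]\to\begin{cases}0,&\text{if } k\ge(1+\varepsilon)\sqrt{2\log_{1/p}n},\\[4pt] 1,&\text{if } k\le(1-\varepsilon)\sqrt{2\log_{1/p}n}.\end{cases}$$
   Context: An $n$-composition is a sequence of $n$ nonnegative integers. For $p=p(n)\in[0,1)$ and $q=1-p$, the geometric random composition $\mathbf{C}_{n,p}$ is the random $n$-composition whose terms are independent, with $\mathbb{P}[\mathbf{C}_{n,p}(i)=j]=qp^j$ for every $j\ge0$ and $i\in\{1,\dots,n\}$. A composition $C$ contains an increasing run of length $k$ if there are $k$ consecutive terms $C(i)<C(i+1)<\dots<C(i+k-1)$ (strictly increasing; the run need not be maximal). For positive functions of $n$: $f\ll g$ means $\lim_{n\to\infty} f/g=0$. *)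

theory Defs
  imports "HOL-Probability.Probability" "HOL-Library.Landau_Symbols"
begin

text \<open>
  An \<open>n\<close>-composition is a function \<open>C :: nat \<Rightarrow> nat\<close> of which only the terms \<open>C 1, \<dots>, C n\<close>
  matter; \<^const>\<open>Pi_pmf\<close> makes these independent and sets all other values to the default \<open>0\<close>.
  The library's \<^const>\<open>geometric_pmf\<close> is parametrised by the probability of the value \<open>0\<close>,
  which here is \<open>q = 1 - p\<close>.
\<close>

definition geometric_composition :: "nat \<Rightarrow> real \<Rightarrow> (nat \<Rightarrow> nat) pmf" where
  "geometric_composition n p = Pi_pmf {1..n} 0 (\<lambda>_. geometric_pmf (1 - p))"

definition contains_increasing_run :: "nat \<Rightarrow> (nat \<Rightarrow> nat) \<Rightarrow> nat \<Rightarrow> bool" where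
  "contains_increasing_run n C k \<longleftrightarrow>
     (\<exists>i\<ge>1. i + k - 1 \<le> n \<and> strict_mono_on {i..i + k - 1} C)"

lemma pmf_geometric_composition_component:
  assumes "0 \<le> p" "p < 1" "i \<in> {1..n}"
  shows   "measure_pmf.prob (geometric_composition n p) {C. C i = j} = (1 - p) * p ^ j"
proof -
  have "measure_pmf.prob (geometric_composition n p) {C. C i = j}
        = pmf (map_pmf (\<lambda>C. C i) (geometric_composition n p)) j"
    by (simp add: pmf_map vimage_def)
  also have "map_pmf (\<lambda>C. C i) (geometric_composition n p) = geometric_pmf (1 - p)"
    using assms by (simp add: geometric_composition_def Pi_pmf_component)
  finally show ?thesis
    using assms by simp
qed

end

theory Submission
  imports Defs "HOL-Real_Asymp.Real_Asymp"
begin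

text \<open>
  Write \<open>L = log\<^bsub>1/p\<^esub> n\<close> and \<open>s = sqrt (2 * L)\<close>, so that \<open>p powr L = 1 / n\<close>. The hypothesis that
  \<open>p\<close> decays more slowly than every power of \<open>n\<close> says exactly that \<open>L\<close>, and hence \<open>s\<close>, tends to
  infinity. The cheapest increasing run of length \<open>k\<close> is \<open>0, 1, \<dots>, k - 1\<close>, and everything rests on
  the fact that the probability of a run at a given place is about that of this single pattern,
  namely \<open>p\<close> to a power close to \<open>k\<^sup>2 / 2\<close>. A run should therefore occur somewhere as soon as
  \<open>k\<^sup>2 / 2\<close> is below \<open>L\<close>, that is, as soon as \<open>k\<close> is below \<open>s\<close>.

  If \<open>k \<ge> (1 + \<epsilon>) * s\<close>, the first moment suffices. The \<open>j\<close>-th term of an increasing run, counted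
  from \<open>0\<close>, is at least \<open>j\<close>; since a geometric variable is at least \<open>j\<close> with probability \<open>p ^ j\<close>,
  a run starts at a given place with probability at most \<open>p\<close> to the power \<open>0 + 1 + \<dots> + (k - 1)\<close>.
  Summing over at most \<open>n\<close> places (\<open>prob_contains_run_le\<close>) gives at most \<open>n powr (- \<epsilon>)\<close>.

  If \<open>k \<le> (1 - \<epsilon>) * s\<close>, cut the composition into \<open>n div k\<close> disjoint blocks of length \<open>k\<close>. They are
  independent, and each is exactly \<open>0, 1, \<dots>, k - 1\<close> with probability \<open>(1 - p) ^ k\<close> times the
  power above (\<open>prob_no_run_le\<close>). As soon as \<open>p \<le> 1 / 2\<close>, the factor \<open>(1 - p) ^ k\<close> is at least
  \<open>p ^ k\<close>, which only replaces the exponent \<open>k (k - 1) / 2\<close> by \<open>k (k + 1) / 2\<close>. So a block succeeds with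
  probability at least \<open>n powr (\<epsilon> - 1)\<close>, while there are about \<open>n / k\<close> blocks and \<open>k\<close> is at
  most of order \<open>sqrt (ln n)\<close>; the expected number of successful blocks tends to infinity, and by
  independence some block succeeds with probability tending to \<open>1\<close>.
\<close>

section \<open>Events on independent coordinates\<close>

lemma prob_Pi_pmf_coordinates:
  assumes "finite I" "J \<subseteq> I"
  shows "measure_pmf.prob (Pi_pmf I d P) {C. \<forall>i\<in>J. C i \<in> S i} =
           (\<Prod>i\<in>J. measure_pmf.prob (P i) (S i))"
proof -
  let ?S = "\<lambda>i. if i \<in> J then S i else UNIV"
  have "{C. \<forall>i\<in>J. C i \<in> S i} = Pi I ?S"
    using assms by (fastforce simp: Pi_def)
  then have "measure_pmf.prob (Pi_pmf I d P) {C. \<forall>i\<in>J. C i \<in> S i} =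
      (\<Prod>i\<in>I. measure_pmf.prob (P i) (?S i))"
    using measure_Pi_pmf_Pi[OF assms(1), of d P ?S] by simp
  also have "\<dots> = (\<Prod>i\<in>J. measure_pmf.prob (P i) (S i))"
    using assms by (intro prod.mono_neutral_cong_right) auto
  finally show ?thesis .
qed

text \<open>Restrictions of \<open>C\<close> to disjoint sets of coordinates are independent, so the failures are, too.\<close>

lemma prob_Pi_pmf_all_blocks_fail:
  assumes I: "finite I" and B: "finite B"
    and J: "\<And>b. b \<in> B \<Longrightarrow> J b \<subseteq> I" and disj: "disjoint_family_on J B"
  shows "measure_pmf.prob (Pi_pmf I d P) {C. \<forall>b\<in>B. \<not> (\<forall>i\<in>J b. C i \<in> S i)} =
           (\<Prod>b\<in>B. 1 - (\<Prod>i\<in>J b. measure_pmf.prob (P i) (S i)))"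
proof (cases "B = {}")
  case False
  let ?M = "measure_pmf (Pi_pmf I d P)"
  let ?prob = "measure_pmf.prob (Pi_pmf I d P)"
  let ?fail = "\<lambda>b. space (PiM (J b) (\<lambda>_. count_space UNIV)) - Pi\<^sub>E (J b) S"
  have fail_sets: "?fail b \<in> sets (PiM (J b) (\<lambda>_. count_space UNIV))" if "b \<in> B" for b
    using finite_subset[OF J[OF that] I] by (intro sets.compl_sets sets_PiM_I_finite) auto
  have vars: "prob_space.indep_vars ?M (\<lambda>b. PiM (J b) (\<lambda>_. count_space UNIV))
      (\<lambda>b C. restrict (\<lambda>i. C i) (J b)) B"
    by (rule prob_space.indep_vars_restrict[OF measure_pmf.prob_space_axioms
          indep_vars_Pi_pmf[OF I] J disj])
  have fail: "(\<lambda>C. restrict (\<lambda>i. C i) (J b)) -` ?fail b \<inter> space ?M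
      = - {C. \<forall>i\<in>J b. C i \<in> S i}" for b
    by (auto simp: space_PiM PiE_def Pi_def)
  have "{C. \<forall>b\<in>B. \<not> (\<forall>i\<in>J b. C i \<in> S i)}
      = (\<Inter>b\<in>B. (\<lambda>C. restrict (\<lambda>i. C i) (J b)) -` ?fail b \<inter> space ?M)"
    unfolding fail by auto
  also have "?prob \<dots> =
      (\<Prod>b\<in>B. ?prob ((\<lambda>C. restrict (\<lambda>i. C i) (J b)) -` ?fail b \<inter> space ?M))"
    by (rule prob_space.indep_varsD_finite[OF measure_pmf.prob_space_axioms
          vars False B fail_sets])
  also have "\<dots> = (\<Prod>b\<in>B. 1 - (\<Prod>i\<in>J b. measure_pmf.prob (P i) (S i)))"
    unfolding fail
  proof (rule prod.cong[OF refl])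
    fix b assume "b \<in> B"
    have "?prob (- {C. \<forall>i\<in>J b. C i \<in> S i}) = 1 - ?prob {C. \<forall>i\<in>J b. C i \<in> S i}"
      using measure_pmf.prob_compl[of "{C. \<forall>i\<in>J b. C i \<in> S i}"] by (simp add: Compl_eq_Diff_UNIV)
    then show "?prob (- {C. \<forall>i\<in>J b. C i \<in> S i})
        = 1 - (\<Prod>i\<in>J b. measure_pmf.prob (P i) (S i))"
      by (simp only: prob_Pi_pmf_coordinates[OF I J[OF \<open>b \<in> B\<close>]])
  qed
  finally show ?thesis .
qed simp

lemma prob_geometric_atLeast:
  assumes "0 \<le> p" "p < 1"
  shows "measure_pmf.prob (geometric_pmf (1 - p)) {j..} = p ^ j"
proof -
  have "{j..} = UNIV - {..<j}" by auto
  then have "measure_pmf.prob (geometric_pmf (1 - p)) {j..}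
      = 1 - measure_pmf.prob (geometric_pmf (1 - p)) {..<j}"
    using measure_pmf.prob_compl[of "{..<j}" "geometric_pmf (1 - p)"] by simp
  also have "measure_pmf.prob (geometric_pmf (1 - p)) {..<j} = (1 - p) * (\<Sum>i<j. p ^ i)"
    using assms by (simp add: measure_measure_pmf_finite sum_distrib_left mult.commute)
  also have "\<dots> = 1 - p ^ j"
    by (rule one_diff_power_eq[symmetric])
  finally show ?thesis by simp
qed

section \<open>Probability bounds for increasing runs\<close>

lemma strict_mono_on_nat_ge_offset:
  fixes C :: "nat \<Rightarrow> nat"
  assumes "strict_mono_on {i..i + k - 1} C" "j < k"
  shows "j \<le> C (i + j)"
  using assms(2)
proof (induction j)
  case (Suc j)
  then have "C (i + j) < C (i + Suc j)"
    by (intro strict_mono_onD[OF assms(1)]) auto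
  with Suc show ?case by simp
qed simp

lemma prob_contains_run_le:
  assumes p: "0 \<le> p" "p < 1" and k: "k > 0"
  shows "measure_pmf.prob (geometric_composition n p) {C. contains_increasing_run n C k}
           \<le> real n * p ^ (\<Sum>j<k. j)"
proof -
  let ?G = "geometric_composition n p"
  let ?W = "{i \<in> {1..n}. i + k - 1 \<le> n}"
  let ?E = "\<lambda>i. {C :: nat \<Rightarrow> nat. \<forall>l\<in>{i..<i + k}. C l \<in> {l - i..}}"
  have window: "measure_pmf.prob ?G (?E i) = p ^ (\<Sum>j<k. j)" if "i \<in> ?W" for i
  proof -
    have "measure_pmf.prob ?G (?E i) = (\<Prod>l\<in>{i..<i + k}. p ^ (l - i))"
      unfolding geometric_composition_def
      using that p by (subst prob_Pi_pmf_coordinates) (auto simp: prob_geometric_atLeast)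
    also have "\<dots> = (\<Prod>j<k. p ^ j)"
      by (rule prod.reindex_bij_witness[of _ "\<lambda>j. i + j" "\<lambda>l. l - i"]) auto
    finally show ?thesis by (simp add: power_sum)
  qed
  have "{C. contains_increasing_run n C k} \<subseteq> (\<Union>i\<in>?W. ?E i)"
  proof
    fix C assume "C \<in> {C. contains_increasing_run n C k}"
    then obtain i where i: "i \<ge> 1" "i + k - 1 \<le> n" "strict_mono_on {i..i + k - 1} C"
      by (auto simp: contains_increasing_run_def)
    have "C l \<in> {l - i..}" if "l \<in> {i..<i + k}" for l
      using strict_mono_on_nat_ge_offset[OF i(3), of "l - i"] that by auto
    with i k show "C \<in> (\<Union>i\<in>?W. ?E i)" by (intro UN_I[of i]) auto
  qed
  then have "measure_pmf.prob ?G {C. contains_increasing_run n C k}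
      \<le> measure_pmf.prob ?G (\<Union>i\<in>?W. ?E i)"
    by (intro measure_pmf.finite_measure_mono) auto
  also have "\<dots> \<le> (\<Sum>i\<in>?W. measure_pmf.prob ?G (?E i))"
    by (rule measure_pmf.finite_measure_subadditive_finite) auto
  also have "\<dots> = real (card ?W) * p ^ (\<Sum>j<k. j)"
    using window by simp
  also have "\<dots> \<le> real n * p ^ (\<Sum>j<k. j)"
  proof -
    have "card ?W \<le> card {1..n}" by (rule card_mono) auto
    with p show ?thesis by (intro mult_right_mono) auto
  qed
  finally show ?thesis .
qed

lemma prob_no_run_le:
  assumes p: "0 \<le> p" "p < 1" and k: "k > 0"
  shows "1 - measure_pmf.prob (geometric_composition n p) {C. contains_increasing_run n C k}
           \<le> (1 - (1 - p) ^ k * p ^ (\<Sum>j<k. j)) ^ (n div k)"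
proof -
  let ?G = "geometric_composition n p"
  define J where "J b = {b * k + 1..b * k + k}" for b :: nat
  define S where "S i = {(i - 1) mod k}" for i :: nat
  have J_sub: "J b \<subseteq> {1..n}" if "b < n div k" for b
  proof -
    have "Suc b * k \<le> n div k * k" using that by (intro mult_le_mono1) simp
    also have "\<dots> \<le> n" by (rule div_times_less_eq_dividend)
    finally show ?thesis by (auto simp: J_def)
  qed
  \<comment> \<open>The block containing \<open>i\<close> can be read off as the quotient of \<open>i - 1\<close> by \<open>k\<close>.\<close>
  have quot: "(i - 1) div k = b" if "i \<in> J b" for i b
  proof -
    have "i - 1 = b * k + (i - 1 - b * k)" "i - 1 - b * k < k"
      using that by (auto simp: J_def)
    then show ?thesis by (metis div_mult_self3 div_less k add.right_neutral less_not_refl)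
  qed
  have rem: "(i - 1) mod k = i - 1 - b * k" if "i \<in> J b" for i b
    using quot[OF that] by (metis minus_div_mult_eq_mod)
  have disj: "disjoint_family_on J {..<n div k}"
    using quot unfolding disjoint_family_on_def by blast
  have success: "(\<Prod>i\<in>J b. measure_pmf.prob (geometric_pmf (1 - p)) (S i))
      = (1 - p) ^ k * p ^ (\<Sum>j<k. j)" for b
  proof -
    have "(\<Prod>i\<in>J b. measure_pmf.prob (geometric_pmf (1 - p)) (S i))
        = (\<Prod>i\<in>J b. (1 - p) * p ^ ((i - 1) mod k))"
      using p by (simp add: S_def measure_pmf_single mult.commute)
    also have "\<dots> = (\<Prod>j<k. (1 - p) * p ^ j)"
      by (rule prod.reindex_bij_witness[of _ "\<lambda>j. b * k + 1 + j" "\<lambda>i. i - 1 - b * k"])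
         (use rem in \<open>auto simp: J_def\<close>)
    finally show ?thesis by (simp add: prod.distrib power_sum)
  qed
  have run: "contains_increasing_run n C k" if b: "b < n div k" and C: "\<forall>i\<in>J b. C i \<in> S i" for b C
    unfolding contains_increasing_run_def
  proof (intro exI conjI)
    show "b * k + 1 \<ge> 1" by simp
    show "b * k + 1 + k - 1 \<le> n" using J_sub[OF b] k by (auto simp: J_def)
    have "C i = i - 1 - b * k" if "i \<in> J b" for i
      using C that rem[OF that] by (auto simp: S_def)
    then show "strict_mono_on {b * k + 1..b * k + 1 + k - 1} C"
      by (auto simp: J_def intro!: strict_mono_onI)
  qed
  have "1 - measure_pmf.prob ?G {C. contains_increasing_run n C k}
      = measure_pmf.prob ?G (- {C. contains_increasing_run n C k})"
    using measure_pmf.prob_compl[of "{C. contains_increasing_run n C k}" ?G]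
    by (simp add: Compl_eq_Diff_UNIV)
  also have "\<dots> \<le> measure_pmf.prob ?G {C. \<forall>b\<in>{..<n div k}. \<not> (\<forall>i\<in>J b. C i \<in> S i)}"
    using run by (intro measure_pmf.finite_measure_mono) auto
  also have "\<dots> = (\<Prod>b\<in>{..<n div k}. 1 - (1 - p) ^ k * p ^ (\<Sum>j<k. j))"
    unfolding geometric_composition_def
    by (subst prob_Pi_pmf_all_blocks_fail) (use J_sub disj success in auto)
  finally show ?thesis by simp
qed

section \<open>The scale of the threshold\<close>

lemma real_sum_lessThan: "real (\<Sum>j<k. j) = real k * (real k - 1) / 2"
  by (induction k) (auto simp: field_simps)

lemma eventually_half_and_pos:
  fixes p :: "nat \<Rightarrow> real"
  assumes p0: "\<And>n. 0 \<le> p n"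
    and p_lower: "\<And>\<delta>::real. \<delta> > 0 \<Longrightarrow> (\<lambda>n. real n powr (-\<delta>)) \<in> o(p)"
    and p_upper: "p \<in> o(\<lambda>_. 1)"
  shows "\<forall>\<^sub>F n in sequentially. 0 < p n \<and> p n \<le> 1 / 2"
proof -
  have "\<forall>\<^sub>F n in sequentially. norm (real n powr (-1)) \<le> 1 * norm (p n)"
    by (rule landau_o.smallD[OF p_lower]) auto
  moreover have "\<forall>\<^sub>F n in sequentially. norm (p n) \<le> 1 / 2 * norm (1 :: real)"
    by (rule landau_o.smallD[OF p_upper]) auto
  ultimately show ?thesis
    using eventually_gt_at_top[of 0]
  proof eventually_elim
    case (elim n)
    have "0 < real n powr (-1)" using elim by simp
    also have "real n powr (-1) \<le> p n" using elim p0[of n] by simp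
    finally show ?case using elim p0[of n] by simp
  qed
qed

text \<open>
  The bound \<open>n powr (- 1 / K) \<le> p\<close> is, after taking logarithms to the base \<open>1 / p\<close>, the bound \<open>K \<le> L\<close>.
\<close>

lemma filterlim_log_inverse_at_top:
  fixes p :: "nat \<Rightarrow> real"
  assumes p0: "\<And>n. 0 \<le> p n"
    and p_lower: "\<And>\<delta>::real. \<delta> > 0 \<Longrightarrow> (\<lambda>n. real n powr (-\<delta>)) \<in> o(p)"
    and p_upper: "p \<in> o(\<lambda>_. 1)"
  shows "filterlim (\<lambda>n. log (1 / p n) (real n)) at_top sequentially"
  unfolding filterlim_at_top_gt[where c = 0]
proof (intro allI impI)
  fix K :: real assume K: "K > 0"
  have "\<forall>\<^sub>F n in sequentially. norm (real n powr (-(1 / K))) \<le> 1 * norm (p n)"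
    by (rule landau_o.smallD[OF p_lower]) (use K in auto)
  moreover have "\<forall>\<^sub>F n in sequentially. 0 < p n \<and> p n \<le> 1 / 2"
    by (rule eventually_half_and_pos[OF assms])
  ultimately show "\<forall>\<^sub>F n in sequentially. K \<le> log (1 / p n) (real n)"
    using eventually_gt_at_top[of 0]
  proof eventually_elim
    case (elim n)
    have "ln (real n powr (-(1 / K))) \<le> ln (p n)"
      using elim by (subst ln_le_cancel_iff) auto
    then have "- ln (p n) * K \<le> ln (real n)"
      using elim K by (simp add: ln_powr field_simps)
    moreover have "ln (p n) < 0" using elim by simp
    ultimately show ?case
      using elim by (simp add: log_def ln_div field_simps)
  qed
qed

lemma powr_log_inverse:
  fixes p x :: real
  assumes "0 < p" "p < 1" "x > 0"
  shows "p powr (c * log (1 / p) x) = x powr (- c)"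
proof -
  have "ln p \<noteq> 0" using assms by simp
  then show ?thesis using assms by (simp add: powr_def log_def ln_div)
qed

section \<open>The threshold\<close>

text \<open>
  The slack \<open>\<epsilon> * s \<ge> 1\<close> absorbs the linear term of \<open>k (k - 1) / 2\<close>, so that one factor \<open>1 + \<epsilon>\<close>
  of the leading term \<open>(1 + \<epsilon>)\<^sup>2 * s\<^sup>2 / 2\<close> survives.
\<close>

lemma prob_contains_run_le_powr:
  fixes p \<epsilon> :: real
  defines "s \<equiv> \<lambda>n. sqrt (2 * log (1 / p) (real n))"
  assumes p: "0 < p" "p < 1" and n: "n \<ge> 1" and k: "k > 0" and eps: "\<epsilon> > 0"
    and slack: "1 / \<epsilon> \<le> s n" and large: "(1 + \<epsilon>) * s n \<le> real k"
  shows "measure_pmf.prob (geometric_composition n p) {C. contains_increasing_run n C k}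
           \<le> real n powr (- \<epsilon>)"
proof -
  define t where "t = s n"
  have L: "log (1 / p) (real n) = t * t / 2"
    using p n by (simp add: t_def s_def zero_le_log_cancel_iff)
  have t: "\<epsilon> * t \<ge> 1" "t > 0"
    using slack eps by (auto simp: t_def field_simps intro: less_le_trans[of 0 "1 / \<epsilon>"])
  have "(1 + \<epsilon>) * t * t \<le> ((1 + \<epsilon>) * t) * ((1 + \<epsilon>) * t - 1)"
    using t eps by (simp only: mult.assoc) (intro mult_left_mono, auto simp: algebra_simps)
  also have "\<dots> \<le> real k * (real k - 1)"
    using large t eps unfolding t_def[symmetric]
    by (intro mult_mono) (auto simp: algebra_simps)
  finally have expo: "(1 + \<epsilon>) * log (1 / p) (real n) \<le> real (\<Sum>j<k. j)"
    unfolding real_sum_lessThan L by simp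
  have "p ^ (\<Sum>j<k. j) = p powr real (\<Sum>j<k. j)"
    by (rule powr_realpow[symmetric]) (fact p)
  also have "\<dots> \<le> p powr ((1 + \<epsilon>) * log (1 / p) (real n))"
    using expo p by (intro powr_mono') auto
  also have "\<dots> = real n powr (- (1 + \<epsilon>))"
    using p n by (intro powr_log_inverse) auto
  finally have "real n * p ^ (\<Sum>j<k. j) \<le> real n powr 1 * real n powr (- (1 + \<epsilon>))"
    using n by (simp add: mult_left_mono)
  also have "\<dots> = real n powr (- \<epsilon>)"
    by (subst powr_add[symmetric]) simp
  finally show ?thesis
    using prob_contains_run_le[of p k n] p k by linarith
qed

text \<open>
  Here \<open>\<epsilon> * s \<ge> 1\<close> absorbs the linear term of \<open>k (k + 1) / 2\<close>. The length of a
  block is at most \<open>s\<close>, and \<open>p \<le> 1 / 2\<close> gives \<open>L \<le> 2 * ln n\<close>, hence \<open>s \<le> 2 * sqrt (ln n)\<close>.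
\<close>

lemma prob_no_run_le_exp:
  fixes p \<epsilon> :: real
  defines "s \<equiv> \<lambda>n. sqrt (2 * log (1 / p) (real n))"
  assumes p: "0 < p" "p \<le> 1 / 2" and n: "n \<ge> 1" and k: "k > 0" and eps: "\<epsilon> > 0"
    and slack: "1 / \<epsilon> \<le> s n" and small: "real k \<le> (1 - \<epsilon>) * s n"
  shows "1 - measure_pmf.prob (geometric_composition n p) {C. contains_increasing_run n C k}
           \<le> exp (- (real n powr (\<epsilon> - 1) * (real n / (2 * sqrt (ln (real n))) - 1)))"
proof -
  define t where "t = s n"
  define r where "r = (1 - p) ^ k * p ^ (\<Sum>j<k. j)"
  have L: "log (1 / p) (real n) = t * t / 2"
    using p n by (simp add: t_def s_def zero_le_log_cancel_iff)
  have t: "\<epsilon> * t \<ge> 1" "t > 0"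
    using slack eps by (auto simp: t_def field_simps intro: less_le_trans[of 0 "1 / \<epsilon>"])
  have k1: "real k \<ge> 1" using k by simp
  have "real k * (real k + 1) \<le> ((1 - \<epsilon>) * t) * ((1 - \<epsilon>) * t + 1)"
    using small k1 unfolding t_def[symmetric] by (intro mult_mono; linarith)
  also have "\<dots> \<le> ((1 - \<epsilon>) * t) * t"
  proof (rule mult_left_mono)
    show "(1 - \<epsilon>) * t + 1 \<le> t" using t by (simp add: algebra_simps)
    show "0 \<le> (1 - \<epsilon>) * t" using small k1 unfolding t_def[symmetric] by linarith
  qed
  finally have expo: "real (k + (\<Sum>j<k. j)) \<le> (1 - \<epsilon>) * log (1 / p) (real n)"
    unfolding of_nat_add real_sum_lessThan L by (simp add: field_simps)
  have "real n powr (\<epsilon> - 1) = real n powr (- (1 - \<epsilon>))" by simp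
  also have "\<dots> = p powr ((1 - \<epsilon>) * log (1 / p) (real n))"
    using p n by (intro powr_log_inverse[symmetric]) auto
  also have "\<dots> \<le> p powr real (k + (\<Sum>j<k. j))"
    using expo p by (intro powr_mono') auto
  also have "\<dots> = p ^ k * p ^ (\<Sum>j<k. j)"
    using p by (simp only: powr_realpow power_add)
  also have "\<dots> \<le> r"
    unfolding r_def using p by (intro mult_right_mono power_mono) auto
  finally have r_ge: "real n powr (\<epsilon> - 1) \<le> r" .
  have r_le: "r \<le> 1"
    unfolding r_def using p by (intro mult_le_one power_le_one) auto
  have "ln (1 / p) \<ge> 1 / 2"
  proof -
    have "1 - 1 / 2 \<le> ln (2 :: real)" using ln_ge_iff[of 2 "1 / 2"] exp_half_le2 by simp
    also have "\<dots> \<le> ln (1 / p)" using p by (subst ln_le_cancel_iff) (auto simp: field_simps)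
    finally show ?thesis by simp
  qed
  then have "log (1 / p) (real n) \<le> ln (real n) / (1 / 2)"
    unfolding log_def using n by (intro divide_left_mono) auto
  then have "t \<le> sqrt (4 * ln (real n))"
    unfolding t_def s_def by (intro real_sqrt_le_mono) simp
  also have "\<dots> = 2 * sqrt (ln (real n))" by (simp add: real_sqrt_mult)
  finally have "real k \<le> 2 * sqrt (ln (real n))"
    using small eps t unfolding t_def[symmetric] by (simp add: algebra_simps)
  then have "real n / (2 * sqrt (ln (real n))) \<le> real n / real k"
    using k1 by (intro divide_left_mono mult_pos_pos; linarith)
  also have "\<dots> \<le> real (n div k) + 1"
  proof -
    have "n \<le> Suc (n div k) * k" using dividend_less_div_times[OF k, of n] by simp
    then have "real n \<le> real (Suc (n div k) * k)" by (rule of_nat_mono)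
    with k show ?thesis by (simp add: field_simps)
  qed
  finally have blocks: "real n / (2 * sqrt (ln (real n))) - 1 \<le> real (n div k)" by simp
  have "1 - measure_pmf.prob (geometric_composition n p) {C. contains_increasing_run n C k}
      \<le> (1 - r) ^ (n div k)"
    unfolding r_def using p k by (intro prob_no_run_le) auto
  also have "\<dots> \<le> exp (- r) ^ (n div k)"
    using r_le exp_ge_add_one_self[of "- r"] by (intro power_mono) auto
  also have "\<dots> = exp (- (r * real (n div k)))"
    by (simp add: exp_of_nat_mult[symmetric] mult.commute)
  also have "\<dots> \<le> exp (- (real n powr (\<epsilon> - 1) * (real n / (2 * sqrt (ln (real n))) - 1)))"
  proof -
    have "real n powr (\<epsilon> - 1) * (real n / (2 * sqrt (ln (real n))) - 1)
        \<le> real n powr (\<epsilon> - 1) * real (n div k)"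
      using blocks by (intro mult_left_mono) auto
    also have "\<dots> \<le> r * real (n div k)"
      using r_ge by (intro mult_right_mono) auto
    finally show ?thesis by simp
  qed
  finally show ?thesis .
qed

theorem proposition4p18:
  fixes p :: "nat \<Rightarrow> real" and k :: "nat \<Rightarrow> nat" and \<epsilon> :: real
  assumes p_range: "\<And>n. 0 \<le> p n \<and> p n < 1"
    and p_lower: "\<And>\<delta>::real. \<delta> > 0 \<Longrightarrow> (\<lambda>n. real n powr (-\<delta>)) \<in> o(p)"
    and p_upper: "p \<in> o(\<lambda>_. 1)"
    and eps: "\<epsilon> > 0"
    and k_pos: "\<And>n. k n > 0"
  shows "((\<forall>\<^sub>F n in sequentially. real (k n) \<ge> (1 + \<epsilon>) * sqrt (2 * log (1 / p n) (real n))) \<longrightarrow>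
           (\<lambda>n. measure_pmf.prob (geometric_composition n (p n))
                  {C. contains_increasing_run n C (k n)}) \<longlonglongrightarrow> 0)
       \<and> ((\<forall>\<^sub>F n in sequentially. real (k n) \<le> (1 - \<epsilon>) * sqrt (2 * log (1 / p n) (real n))) \<longrightarrow>
           (\<lambda>n. measure_pmf.prob (geometric_composition n (p n))
                  {C. contains_increasing_run n C (k n)}) \<longlonglongrightarrow> 1)"
proof -
  let ?P = "\<lambda>n. measure_pmf.prob (geometric_composition n (p n))
                  {C. contains_increasing_run n C (k n)}"
  let ?s = "\<lambda>n. sqrt (2 * log (1 / p n) (real n))"
  have p0: "\<And>n. 0 \<le> p n" using p_range by simp
  have p_ev: "\<forall>\<^sub>F n in sequentially. 0 < p n \<and> p n \<le> 1 / 2"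
    by (rule eventually_half_and_pos[OF p0 p_lower p_upper])
  have "filterlim ?s at_top sequentially"
    by (intro filterlim_compose[OF sqrt_at_top] filterlim_tendsto_pos_mult_at_top[OF tendsto_const]
        filterlim_log_inverse_at_top[OF p0 p_lower p_upper]) auto
  then have slack: "\<forall>\<^sub>F n in sequentially. 1 / \<epsilon> \<le> ?s n"
    by (simp add: filterlim_at_top)
  have "?P \<longlonglongrightarrow> 0" if "\<forall>\<^sub>F n in sequentially. real (k n) \<ge> (1 + \<epsilon>) * ?s n"
  proof (rule tendsto_sandwich[OF _ _ tendsto_const])
    show "\<forall>\<^sub>F n in sequentially. 0 \<le> ?P n" by simp
    show "\<forall>\<^sub>F n in sequentially. ?P n \<le> real n powr (- \<epsilon>)"
      using that p_ev slack eventually_ge_at_top[of 1]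
    proof eventually_elim
      case (elim n)
      then show ?case
        using eps k_pos by (intro prob_contains_run_le_powr) auto
    qed
    show "(\<lambda>n. real n powr (- \<epsilon>)) \<longlonglongrightarrow> 0" using eps by real_asymp
  qed
  moreover have "?P \<longlonglongrightarrow> 1" if small: "\<forall>\<^sub>F n in sequentially. real (k n) \<le> (1 - \<epsilon>) * ?s n"
  proof -
    let ?err = "\<lambda>n. exp (- (real n powr (\<epsilon> - 1) * (real n / (2 * sqrt (ln (real n))) - 1)))"
    \<comment> \<open>For \<open>\<epsilon> \<ge> 1\<close> the upper bound on \<open>k n\<close> would eventually be at most \<open>0\<close>, but \<open>k n > 0\<close>.\<close>
    have "\<forall>\<^sub>F n in sequentially. \<epsilon> < 1"
      using small slack
    proof eventually_elim
      case (elim n)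
      have "?s n > 0" using elim eps by (smt (verit) divide_pos_pos)
      moreover have "0 < (1 - \<epsilon>) * ?s n" using elim k_pos[of n] by linarith
      ultimately show ?case by (simp add: zero_less_mult_iff)
    qed
    then have eps1: "\<epsilon> < 1" by simp
    show ?thesis
    proof (rule tendsto_sandwich[OF _ _ _ tendsto_const])
      show "\<forall>\<^sub>F n in sequentially. ?P n \<le> 1" by simp
      have "\<forall>\<^sub>F n in sequentially. 1 - ?P n \<le> ?err n"
        using small p_ev slack eventually_ge_at_top[of 1]
      proof eventually_elim
        case (elim n)
        then show ?case
          using eps k_pos by (intro prob_no_run_le_exp) auto
      qed
      then show "\<forall>\<^sub>F n in sequentially. 1 - ?err n \<le> ?P n"
        by eventually_elim simp
      show "(\<lambda>n. 1 - ?err n) \<longlonglongrightarrow> 1" using eps eps1 by real_asymp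
    qed
  qed
  ultimately show ?thesis by blast
qed

end
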